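(* Let $r\ge 1$ and $k\ge 2$ be integers, let $\mathbf a=(a_1,\dots,a_r)$ be a sequence of positive integers, and let $D=\operatorname{lcm}(a_1,\dots,a_r)$. Put $$\mathbf C=\Big\{(\ell_1,\dots,\ell_r)\in\mathbb Z^r : 0\le \ell_s\le k\Big(\frac{D}{a_s}-1\Big)\text{ for }1\le s\le r\Big\}.$$ Then for every integer $n\ge 0$, the restricted $k$-multipartition function $p_{k,\mathbf a}$ satisfies $$p_{k,\mathbf a}(n)=\frac{1}{(rk-1)!}\sum_{\substack{(\ell_1,\dots,\ell_r)\in\mathbf C\\ a_1\ell_1+\cdots+a_r\ell_r\equiv n\ (\mathrm{mod}\ D)}}\left[\prod_{s=1}^r\left(\sum_{\substack{i_s,j_s\ge 0\\ i_s\frac{D}{a_s}+j_s=\ell_s}}(-1)^{i_s}\binom{k}{i_s}\binom{j_s+k-1}{j_s}\right)\right]\cdot\prod_{t=1}^{rk-1}\left(\frac{n-a_1\ell_1-\cdots-a_r\ell_r}{D}+t\right).$$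
   Context: For integers $n\ge 0$, $p_{k,\mathbf a}(n)$ is the number of $k$-tuples $(x^1,\dots,x^k)$ of vectors $x^j=(x^j_1,\dots,x^j_r)\in\mathbb N^r$ (with $0\in\mathbb N$) such that $\sum_{j=1}^k\sum_{i=1}^r a_i x^j_i=n$. Equivalently, $\sum_{n\ge 0}p_{k,\mathbf a}(n)z^n=\prod_{i=1}^r(1-z^{a_i})^{-k}$ for $|z|<1$. By convention $\binom{k}{i}=0$ for $i>k$. *)

theory Defs
  imports Complex_Main "HOL-Library.FuncSet" "HOL-Number_Theory.Cong"
begin

text \<open>
  A sequence \<open>a_1, \<dots>, a_r\<close> is a function on \<open>nat\<close> of which only the values on \<open>{1..r}\<close> matter;
  tuples are extensional functions, so that each tuple is counted exactly once.
\<close>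

text \<open>
  The counted set is finite, hence its cardinality is the intended one, whenever
  \<open>a i > 0\<close> for all \<open>i \<in> {1..r}\<close>.
\<close>

definition restricted_multipartition :: "nat \<Rightarrow> nat \<Rightarrow> (nat \<Rightarrow> nat) \<Rightarrow> nat \<Rightarrow> nat" where
  "restricted_multipartition k r a n =
     card {x \<in> {1..k} \<rightarrow>\<^sub>E ({1..r} \<rightarrow>\<^sub>E (UNIV :: nat set)).
             (\<Sum>j=1..k. \<Sum>i=1..r. a i * x j i) = n}"

definition seq_lcm :: "nat \<Rightarrow> (nat \<Rightarrow> nat) \<Rightarrow> nat" where
  "seq_lcm r a = Lcm (a ` {1..r})"

definition box_C :: "nat \<Rightarrow> nat \<Rightarrow> (nat \<Rightarrow> nat) \<Rightarrow> (nat \<Rightarrow> int) set" where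
  "box_C k r a =
     {l \<in> {1..r} \<rightarrow>\<^sub>E (UNIV :: int set).
        \<forall>s\<in>{1..r}. 0 \<le> l s \<and>
          real_of_int (l s) \<le> real k * (real (seq_lcm r a) / real (a s) - 1)}"

end

theory Submission
  imports Defs "HOL-Computational_Algebra.Formal_Power_Series"
begin

unbundle fps_syntax

text \<open>
  The generating function of the counted tuples is \<open>\<Prod>\<^sub>s (1 - z^a\<^sub>s)^(-k)\<close>. The idea is to bring
  all factors to the common denominator \<open>1 - z^D\<close>. With \<open>d\<^sub>s = D / a\<^sub>s\<close> and \<open>u = z^a\<^sub>s\<close> the quotient
  \<open>(1 - z^D)^k / (1 - z^a\<^sub>s)^k = ((1 - u^d\<^sub>s) / (1 - u))^k = (1 + u + \<dots> + u^(d\<^sub>s - 1))^k\<close>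
  is a polynomial in \<open>u\<close> of degree \<open>k (d\<^sub>s - 1)\<close>. Multiplying the binomial expansion of \<open>(1 - u^d\<^sub>s)^k\<close>
  by that of \<open>(1 - u)^(-k)\<close> writes its coefficient of \<open>u^l\<close> as the inner double sum of the formula
  (\<open>genfun_quotient_coeff\<close>), while the degree bound says that these double sums vanish outside
  \<open>0 \<le> l \<le> k (d\<^sub>s - 1)\<close> (\<open>quotient_coeff_eq_0\<close>). This is where the box of exponents comes from.

  Multiplying the \<open>r\<close> numerators together gives a polynomial indexed by the box, and what remains is
  \<open>(1 - z^D)^(-rk) = \<Sum>\<^sub>m binomial (m + rk - 1, m) z^(D m)\<close>. Hence the coefficient of \<open>z^n\<close> collects the
  box points \<open>l\<close> with \<open>\<Sum>\<^sub>s a\<^sub>s l\<^sub>s + D m = n\<close> for some \<open>m \<ge> 0\<close>. That condition forces the congruence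
  modulo \<open>D\<close> and determines \<open>m\<close>, and \<open>(rk - 1)!\<close> times the binomial coefficient is the product
  \<open>(m + 1) \<dots> (m + rk - 1)\<close>.

  The formula also sums over box points for which the integer \<open>m = (n - \<Sum>\<^sub>s a\<^sub>s l\<^sub>s) / D\<close> is negative. They
  contribute nothing: since \<open>a\<^sub>s l\<^sub>s < k D\<close> on the box, \<open>m > - rk\<close>, so one of the factors
  \<open>m + 1, \<dots>, m + rk - 1\<close> is zero (\<open>rising_product_eq_0\<close>).
\<close>

section \<open>Generating functions of weighted families\<close>

text \<open>
  This is the formal series \<open>\<Sum>b\<in>B. c b * X ^ w b\<close>. It represents the family faithfully only if every
  weight is attained finitely often, since a sum over an infinite set is \<open>0\<close> by convention; this is
  what \<open>fin_fibres\<close> below provides.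
\<close>

definition genfun :: "'b set \<Rightarrow> ('b \<Rightarrow> nat) \<Rightarrow> ('b \<Rightarrow> real) \<Rightarrow> real fps" where
  "genfun B w c = Abs_fps (\<lambda>n. \<Sum>b | b \<in> B \<and> w b = n. c b)"

definition fin_fibres :: "'b set \<Rightarrow> ('b \<Rightarrow> nat) \<Rightarrow> bool" where
  "fin_fibres B w \<longleftrightarrow> (\<forall>n. finite {b \<in> B. w b = n})"

lemma genfun_nth: "genfun B w c $ n = (\<Sum>b | b \<in> B \<and> w b = n. c b)"
  by (simp add: genfun_def)

lemma fin_fibres_finite: "finite B \<Longrightarrow> fin_fibres B w"
  by (simp add: fin_fibres_def)

lemma fin_fibres_inj: "inj_on w B \<Longrightarrow> fin_fibres B w"
proof (unfold fin_fibres_def, intro allI)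
  fix n assume inj: "inj_on w B"
  have "inj_on w {b \<in> B. w b = n}" by (rule inj_on_subset[OF inj]) auto
  moreover have "w ` {b \<in> B. w b = n} \<subseteq> {n}" by auto
  ultimately show "finite {b \<in> B. w b = n}"
    by (meson finite.emptyI finite.insertI inj_on_finite)
qed

lemma fin_fibres_le: "fin_fibres B w \<Longrightarrow> finite {b \<in> B. w b \<le> n}"
proof -
  assume "fin_fibres B w"
  then have "finite (\<Union>m\<le>n. {b \<in> B. w b = m})" by (simp add: fin_fibres_def)
  moreover have "{b \<in> B. w b \<le> n} = (\<Union>m\<le>n. {b \<in> B. w b = m})" by auto
  ultimately show ?thesis by simp
qed

lemma fin_fibres_times:
  assumes "fin_fibres A u" "fin_fibres B v"
  shows "fin_fibres (A \<times> B) (\<lambda>(x, y). u x + v y)"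
  unfolding fin_fibres_def
proof
  fix n
  have "finite ({x \<in> A. u x \<le> n} \<times> {y \<in> B. v y \<le> n})"
    using assms by (simp add: fin_fibres_le)
  then show "finite {b \<in> A \<times> B. (case b of (x, y) \<Rightarrow> u x + v y) = n}"
    by (rule finite_subset[rotated]) auto
qed

lemma genfun_mult:
  assumes "fin_fibres A u" "fin_fibres B v"
  shows "genfun A u c * genfun B v d =
         genfun (A \<times> B) (\<lambda>(x, y). u x + v y) (\<lambda>(x, y). c x * d y)"
proof (rule fps_ext)
  fix n
  let ?A = "\<lambda>i. {x \<in> A. u x = i}" and ?B = "\<lambda>i. {y \<in> B. v y = i}"
  have fin: "finite (?A i)" "finite (?B i)" for i
    using assms by (auto simp: fin_fibres_def)
  have "(genfun A u c * genfun B v d) $ n =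
        (\<Sum>i=0..n. \<Sum>p\<in>?A i \<times> ?B (n - i). (\<lambda>(x, y). c x * d y) p)"
    by (simp add: fps_mult_nth genfun_nth sum_product sum.cartesian_product)
  also have "\<dots> = (\<Sum>p\<in>(\<Union>i\<in>{0..n}. ?A i \<times> ?B (n - i)). (\<lambda>(x, y). c x * d y) p)"
    by (rule sum.UNION_disjoint[symmetric]) (use fin in auto)
  also have "(\<Union>i\<in>{0..n}. ?A i \<times> ?B (n - i)) =
             {p \<in> A \<times> B. (case p of (x, y) \<Rightarrow> u x + v y) = n}"
    by auto
  finally show "(genfun A u c * genfun B v d) $ n =
      genfun (A \<times> B) (\<lambda>(x, y). u x + v y) (\<lambda>(x, y). c x * d y) $ n"
    by (simp add: genfun_nth)
qed

text \<open>
  Terms whose weight factors through \<open>g\<close> may be collected along the fibres of \<open>g\<close>. This turns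
  a series indexed by pairs \<open>(i, j)\<close> into one indexed by \<open>i * d + j\<close>.
\<close>

lemma genfun_regroup:
  assumes fin: "fin_fibres A (\<lambda>x. w (g x))" and fin': "fin_fibres B w"
    and g: "g ` A \<subseteq> B"
  shows "genfun A (\<lambda>x. w (g x)) c = genfun B w (\<lambda>b. \<Sum>x | x \<in> A \<and> g x = b. c x)"
proof (rule fps_ext)
  fix n
  let ?S = "{x \<in> A. w (g x) = n}" and ?T = "{b \<in> B. w b = n}"
  have "(\<Sum>x\<in>?S. c x) = (\<Sum>b\<in>?T. \<Sum>x | x \<in> ?S \<and> g x = b. c x)"
    by (rule sum.group[symmetric]) (use fin fin' g in \<open>auto simp: fin_fibres_def\<close>)
  also have "\<dots> = (\<Sum>b\<in>?T. \<Sum>x | x \<in> A \<and> g x = b. c x)"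
    by (intro sum.cong) auto
  finally show "genfun A (\<lambda>x. w (g x)) c $ n =
      genfun B w (\<lambda>b. \<Sum>x | x \<in> A \<and> g x = b. c x) $ n"
    by (simp add: genfun_nth)
qed

lemma genfun_restrict:
  assumes "fin_fibres B w" "B' \<subseteq> B" "\<And>b. b \<in> B - B' \<Longrightarrow> c b = 0"
  shows "genfun B w c = genfun B' w c"
  by (rule fps_ext, unfold genfun_nth, rule sum.mono_neutral_right)
     (use assms in \<open>auto simp: fin_fibres_def\<close>)

lemma bij_betw_PiE_insert:
  assumes "i \<notin> I"
  shows "bij_betw (\<lambda>(y, x). x(i := y)) (B i \<times> PiE I B) (PiE (insert i I) B)"
  unfolding bij_betw_def by (simp add: PiE_insert_eq inj_combinator[OF assms])

lemma genfun_reindex: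
  assumes "bij_betw h A B" "\<And>x. x \<in> A \<Longrightarrow> w (h x) = u x" "\<And>x. x \<in> A \<Longrightarrow> c (h x) = d x"
  shows "genfun A u d = genfun B w c" and "fin_fibres A u \<Longrightarrow> fin_fibres B w"
proof -
  have bij: "bij_betw h {x \<in> A. u x = n} {b \<in> B. w b = n}" for n
    using assms(1,2) by (auto simp: bij_betw_def inj_on_def)
  show "genfun A u d = genfun B w c"
    by (rule fps_ext, unfold genfun_nth, rule sum.reindex_bij_betw[OF bij, THEN trans[rotated]])
       (use assms(3) in \<open>auto intro: sum.cong\<close>)
  show "fin_fibres A u \<Longrightarrow> fin_fibres B w"
    using bij_betw_finite[OF bij] by (simp add: fin_fibres_def)
qed

text \<open>
  Expanding a finite product means choosing one term from each factor: weights add and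
  coefficients multiply. The expansion serves for the \<open>r\<close> coordinates of a vector, for the \<open>k\<close> vectors of a
  tuple, and for the points of the box of exponents.
\<close>

lemma genfun_PiE:
  assumes "finite I" "\<And>i. i \<in> I \<Longrightarrow> fin_fibres (B i) (w i)"
  shows "(\<Prod>i\<in>I. genfun (B i) (w i) (c i)) =
           genfun (PiE I B) (\<lambda>x. \<Sum>i\<in>I. w i (x i)) (\<lambda>x. \<Prod>i\<in>I. c i (x i))"
    and "fin_fibres (PiE I B) (\<lambda>x. \<Sum>i\<in>I. w i (x i))"
proof -
  have "(\<Prod>i\<in>I. genfun (B i) (w i) (c i)) =
           genfun (PiE I B) (\<lambda>x. \<Sum>i\<in>I. w i (x i)) (\<lambda>x. \<Prod>i\<in>I. c i (x i)) \<and>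
        fin_fibres (PiE I B) (\<lambda>x. \<Sum>i\<in>I. w i (x i))"
    using assms
  proof (induction I rule: finite_induct)
    case empty
    show ?case
      by (auto simp: fin_fibres_finite fps_eq_iff genfun_nth)
  next
    case (insert i I)
    let ?W = "\<lambda>J x. \<Sum>j\<in>J. w j (x j)" and ?C = "\<lambda>J x. \<Prod>j\<in>J. c j (x j)"
    have ff: "fin_fibres (B i) (w i)" "fin_fibres (PiE I B) (?W I)"
      using insert by auto
    have upd: "?W (insert i I) (x(i := y)) = w i y + ?W I x"
      "?C (insert i I) (x(i := y)) = c i y * ?C I x" for x y
    proof -
      have "?W I (x(i := y)) = ?W I x" "?C I (x(i := y)) = ?C I x"
        using \<open>i \<notin> I\<close> by (auto intro!: sum.cong prod.cong)
      then show "?W (insert i I) (x(i := y)) = w i y + ?W I x"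
        "?C (insert i I) (x(i := y)) = c i y * ?C I x"
        using insert.hyps by auto
    qed
    note re = genfun_reindex[OF bij_betw_PiE_insert[OF \<open>i \<notin> I\<close>, of B],
      where w = "?W (insert i I)" and u = "\<lambda>(y, x). w i y + ?W I x"
        and c = "?C (insert i I)" and d = "\<lambda>(y, x). c i y * ?C I x"]
    have "(\<Prod>j\<in>insert i I. genfun (B j) (w j) (c j)) =
          genfun (B i) (w i) (c i) * genfun (PiE I B) (?W I) (?C I)"
      using insert by simp
    also have "\<dots> = genfun (B i \<times> PiE I B) (\<lambda>(y, x). w i y + ?W I x) (\<lambda>(y, x). c i y * ?C I x)"
      by (rule genfun_mult[OF ff])
    also have "\<dots> = genfun (PiE (insert i I) B) (?W (insert i I)) (?C (insert i I))"
      by (rule re(1)) (auto simp only: upd split: prod.split)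
    finally show ?case
      using re(2) fin_fibres_times[OF ff] upd by (simp add: case_prod_beta)
  qed
  then show "(\<Prod>i\<in>I. genfun (B i) (w i) (c i)) =
           genfun (PiE I B) (\<lambda>x. \<Sum>i\<in>I. w i (x i)) (\<lambda>x. \<Prod>i\<in>I. c i (x i))"
    and "fin_fibres (PiE I B) (\<lambda>x. \<Sum>i\<in>I. w i (x i))" by auto
qed

section \<open>Binomial series in a power of the variable\<close>

lemma genfun_multiples:
  assumes "e > 0"
  shows "genfun UNIV (\<lambda>i. e * i) c = Abs_fps c oo fps_X ^ e"
proof (rule fps_ext)
  fix n
  have "(Abs_fps c oo fps_X ^ e) $ n = (\<Sum>i\<in>{0..n}. if e * i = n then c i else 0)"
    by (auto simp: fps_compose_nth simp flip: power_mult intro!: sum.cong)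
  also have "\<dots> = (\<Sum>i | i \<in> {0..n} \<and> e * i = n. c i)"
    by (simp only: sum.inter_filter[symmetric] finite_atLeastAtMost)
  also have "{i. i \<in> {0..n} \<and> e * i = n} = {i. i \<in> UNIV \<and> e * i = n}"
    using assms by auto
  finally show "genfun UNIV (\<lambda>i. e * i) c $ n = (Abs_fps c oo fps_X ^ e) $ n"
    by (simp add: genfun_nth)
qed

lemma fin_fibres_multiples: "e > 0 \<Longrightarrow> fin_fibres UNIV (\<lambda>i::nat. e * i)"
  by (rule fin_fibres_inj) (auto simp: inj_on_def)

lemma genfun_binomial:
  assumes "e > 0"
  shows "genfun UNIV (\<lambda>i. e * i) (\<lambda>i. (-1) ^ i * real (k choose i)) = (1 - fps_X ^ e) ^ k"
proof -
  \<comment> \<open>It suffices to know the series in \<open>X\<close>; substituting \<open>X ^ e\<close> is a ring homomorphism.\<close>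
  have "((1 - fps_X) ^ k :: real fps) = fps_binomial (of_nat k) oo (- fps_X)"
    by (simp add: fps_binomial_of_nat fps_compose_add_distrib flip: fps_compose_power)
  then have "Abs_fps (\<lambda>i. (-1) ^ i * real (k choose i)) = (1 - fps_X) ^ k"
    by (simp add: fps_eq_iff binomial_gbinomial fps_compose_uminus')
  then show ?thesis
    using assms by (simp add: genfun_multiples fps_compose_sub_distrib zero_power
        flip: fps_compose_power)
qed

lemma genfun_negative_binomial:
  assumes "e > 0" "k > 0"
  shows "genfun UNIV (\<lambda>j. e * j) (\<lambda>j. real ((j + k - 1) choose j)) = inverse ((1 - fps_X ^ e) ^ k)"
proof -
  let ?F = "inverse ((1 - fps_X) ^ k) :: real fps"
  have F: "Abs_fps (\<lambda>j. real ((j + k - 1) choose j)) = ?F"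
    using one_minus_const_fps_X_neg_power'[OF \<open>k > 0\<close>, of "1::real"]
    by (simp add: add.commute)
  have X: "(fps_X ^ e :: real fps) $ 0 = 0" using assms by simp
  have "?F * (1 - fps_X) ^ k = 1"
    by (rule inverse_mult_eq_1) (simp add: fps_power_zeroth)
  then have "(?F oo fps_X ^ e) * ((1 - fps_X) ^ k oo fps_X ^ e) = 1"
    by (simp only: fps_compose_mult_distrib[OF X, symmetric] fps_compose_1)
  also have "(1 - fps_X) ^ k oo fps_X ^ e = ((1 - fps_X ^ e) ^ k :: real fps)"
    using assms by (simp add: zero_power fps_compose_sub_distrib flip: fps_compose_power)
  finally have "?F oo fps_X ^ e = inverse ((1 - fps_X ^ e) ^ k)"
    by (metis fps_inverse_unique mult.commute)
  then show ?thesis using assms F by (simp add: genfun_multiples)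
qed

section \<open>The numerator over the common denominator\<close>

text \<open>
  For \<open>d, k > 0\<close> this is the coefficient of \<open>u ^ l\<close> in \<open>((1 - u ^ d) / (1 - u)) ^ k\<close>.
\<close>

definition quotient_coeff :: "nat \<Rightarrow> nat \<Rightarrow> int \<Rightarrow> real" where
  "quotient_coeff k d l =
     (\<Sum>(i, j) \<in> {(i :: nat, j :: nat). int (i * d + j) = l}.
        (-1) ^ i * real (k choose i) * real ((j + k - 1) choose j))"

text \<open>
  Multiply the binomial series of the two factors and collect the pairs \<open>(i, j)\<close> according to
  \<open>i * d + j\<close>. That the resulting series is a polynomial is invisible here, so the exponents run over
  all nonnegative integers.
\<close>

lemma genfun_quotient_coeff_unbounded:
  assumes "a > 0" "d > 0" "k > 0"
  shows "genfun {0..} (\<lambda>l. a * nat l) (quotient_coeff k d) =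
         (1 - fps_X ^ (a * d)) ^ k * inverse ((1 - fps_X ^ a) ^ k)"
proof -
  let ?c = "\<lambda>(i, j). (-1) ^ i * real (k choose i) * real ((j + k - 1) choose j)"
  let ?g = "\<lambda>(i, j). int (i * d + j)"
  have ff: "fin_fibres UNIV (\<lambda>i. a * d * i)" "fin_fibres UNIV (\<lambda>j. a * j)"
    using assms by (simp_all add: fin_fibres_multiples)
  have w: "(\<lambda>p. a * nat (?g p)) = (\<lambda>(i, j). a * d * i + a * j)"
    by (auto simp: algebra_simps nat_add_distrib nat_mult_distrib)
  have "(1 - fps_X ^ (a * d)) ^ k * inverse ((1 - fps_X ^ a) ^ k) =
        genfun UNIV (\<lambda>i. a * d * i) (\<lambda>i. (-1) ^ i * real (k choose i)) *
        genfun UNIV (\<lambda>j. a * j) (\<lambda>j. real ((j + k - 1) choose j))"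
    using assms by (simp only: genfun_binomial genfun_negative_binomial mult_pos_pos)
  also have "\<dots> = genfun UNIV (\<lambda>p. a * nat (?g p)) ?c"
    unfolding w by (subst genfun_mult[OF ff]) simp
  also have "\<dots> = genfun {0..} (\<lambda>l. a * nat l) (\<lambda>l. \<Sum>p | p \<in> UNIV \<and> ?g p = l. ?c p)"
  proof (rule genfun_regroup)
    show "fin_fibres UNIV (\<lambda>p. a * nat (?g p))"
      unfolding w using fin_fibres_times[OF ff] by simp
    show "fin_fibres {0..} (\<lambda>l. a * nat l)"
      by (rule fin_fibres_inj) (use assms in \<open>auto simp: inj_on_def\<close>)
  qed auto
  also have "(\<lambda>l. \<Sum>p | p \<in> UNIV \<and> ?g p = l. ?c p) = quotient_coeff k d"
    by (intro ext, unfold quotient_coeff_def, intro sum.cong) auto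
  finally show ?thesis ..
qed

text \<open>
  The alternating sum vanishes because \<open>(1 - X ^ d) ^ k / (1 - X) ^ k\<close> is also the \<open>k\<close>-th power of
  \<open>1 + X + \<dots> + X ^ (d - 1)\<close>, whose terms are indexed by \<open>k\<close>-tuples of exponents below \<open>d\<close>. No such tuple
  has sum greater than \<open>k (d - 1)\<close>.
\<close>

lemma quotient_coeff_eq_0:
  assumes "d > 0" "k > 0" "l > int (k * (d - 1))"
  shows "quotient_coeff k d l = 0"
proof -
  let ?G = "genfun {..<d} (\<lambda>i. i) (\<lambda>_. 1)"
  define m where "m = nat l"
  have m: "m > k * (d - 1)" "l = int m" using assms unfolding m_def by linarith+
  have "?G $ n = (\<Sum>i<d. fps_X ^ i) $ n" for n
  proof -
    have "{i. i < d \<and> i = n} = (if n < d then {n} else {})" by auto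
    then show ?thesis by (auto simp: genfun_nth fps_sum_nth)
  qed
  then have G: "?G = (\<Sum>i<d. fps_X ^ i)" by (rule fps_ext)
  have one: "inverse ((1 - fps_X) ^ k) * (1 - fps_X) ^ k = (1 :: real fps)"
    by (rule inverse_mult_eq_1) (simp add: fps_power_zeroth)
  have "(1 - fps_X ^ d) ^ k * inverse ((1 - fps_X) ^ k) = (?G ^ k :: real fps)"
    unfolding G one_diff_power_eq power_mult_distrib using one by (simp add: ac_simps)
  also have "?G ^ k = (\<Prod>j\<in>{..<k}. ?G)" by simp
  also have "\<dots> = genfun ({..<k} \<rightarrow>\<^sub>E {..<d}) (\<lambda>x. \<Sum>j<k. x j) (\<lambda>x. \<Prod>j<k. 1)"
    by (rule genfun_PiE(1)) (auto simp: fin_fibres_finite)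
  finally have eq: "genfun {0..} nat (quotient_coeff k d) =
      genfun ({..<k} \<rightarrow>\<^sub>E {..<d}) (\<lambda>x. \<Sum>j<k. x j) (\<lambda>x. \<Prod>j<k. 1)"
    using genfun_quotient_coeff_unbounded[of 1 d k] assms by simp
  have "(\<Sum>j<k. x j) \<noteq> m" if "x \<in> {..<k} \<rightarrow>\<^sub>E {..<d}" for x
  proof -
    have "(\<Sum>j<k. x j) \<le> (\<Sum>j<k. d - 1)"
      by (rule sum_mono) (use that in \<open>force simp: PiE_iff\<close>)
    then show ?thesis using m by simp
  qed
  then have "{x \<in> {..<k} \<rightarrow>\<^sub>E {..<d}. (\<Sum>j<k. x j) = m} = {}" by blast
  then have "genfun {0..} nat (quotient_coeff k d) $ m = 0"
    unfolding eq genfun_nth by (simp only: sum.empty)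
  moreover have "{b. b \<in> {0..} \<and> nat b = m} = {l}" using m by auto
  ultimately show ?thesis by (simp add: genfun_nth)
qed

lemma genfun_quotient_coeff:
  assumes "a > 0" "d > 0" "k > 0"
  shows "genfun {0..int (k * (d - 1))} (\<lambda>l. a * nat l) (quotient_coeff k d) =
         (1 - fps_X ^ (a * d)) ^ k * inverse ((1 - fps_X ^ a) ^ k)"
proof -
  have "genfun {0..} (\<lambda>l. a * nat l) (quotient_coeff k d) =
        genfun {0..int (k * (d - 1))} (\<lambda>l. a * nat l) (quotient_coeff k d)"
  proof (rule genfun_restrict)
    show "fin_fibres {0..} (\<lambda>l. a * nat l)"
      by (rule fin_fibres_inj) (use assms in \<open>auto simp: inj_on_def\<close>)
  qed (use assms quotient_coeff_eq_0 in auto)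
  then show ?thesis using genfun_quotient_coeff_unbounded[OF assms] by simp
qed

section \<open>The generating function of the multipartition counts\<close>

lemma restricted_multipartition_fps:
  assumes "\<And>i. i \<in> {1..r} \<Longrightarrow> a i > 0"
  shows "Abs_fps (\<lambda>n. real (restricted_multipartition k r a n)) =
         (\<Prod>i=1..r. inverse ((1 - fps_X ^ a i) ^ k))"
proof -
  let ?V = "{1..r} \<rightarrow>\<^sub>E (UNIV :: nat set)"
  let ?w = "\<lambda>v. \<Sum>i=1..r. a i * v i"
  have geom: "genfun UNIV (\<lambda>j. a i * j) (\<lambda>_. 1) = inverse (1 - fps_X ^ a i)" if "i \<in> {1..r}" for i
    using genfun_negative_binomial[of "a i" 1] assms[OF that] by simp
  have ff: "fin_fibres UNIV (\<lambda>j. a i * j)" if "i \<in> {1..r}" for i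
    using assms[OF that] by (rule fin_fibres_multiples)
  have "(\<Prod>i=1..r. inverse (1 - fps_X ^ a i)) = (\<Prod>i=1..r. genfun UNIV (\<lambda>j. a i * j) (\<lambda>_. 1))"
    using geom by simp
  also have "\<dots> = genfun ?V ?w (\<lambda>v. \<Prod>i=1..r. 1)"
    by (rule genfun_PiE(1)) (use ff in auto)
  finally have V: "(\<Prod>i=1..r. inverse (1 - fps_X ^ a i)) = genfun ?V ?w (\<lambda>_. 1)" by simp
  have ffV: "fin_fibres ?V ?w"
    by (rule genfun_PiE(2)) (use ff in auto)
  have "(\<Prod>i=1..r. inverse ((1 - fps_X ^ a i) ^ k)) = (\<Prod>j=1..k. genfun ?V ?w (\<lambda>_. 1))"
    by (simp only: fps_inverse_power prod_power_distrib[symmetric] V prod_constant) simp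
  also have "\<dots> = genfun ({1..k} \<rightarrow>\<^sub>E ?V) (\<lambda>x. \<Sum>j=1..k. ?w (x j)) (\<lambda>x. \<Prod>j=1..k. 1)"
    by (rule genfun_PiE(1)) (use ffV in auto)
  also have "\<dots> = Abs_fps (\<lambda>n. real (restricted_multipartition k r a n))"
    by (simp add: fps_eq_iff genfun_nth restricted_multipartition_def)
  finally show ?thesis ..
qed

section \<open>The product of consecutive factors\<close>

lemma rising_product_eq_binomial:
  "(\<Prod>t=1..q. real m + real t) = fact q * real ((m + q) choose m)"
proof -
  have "fact m * (\<Prod>t=1..q. real m + real t) = fact (m + q)"
  proof (induction q)
    case (Suc q)
    have "fact m * (\<Prod>t=1..Suc q. real m + real t) =
          (fact m * (\<Prod>t=1..q. real m + real t)) * (real m + real (Suc q))"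
      by simp
    also have "\<dots> = fact (m + Suc q)" unfolding Suc.IH by (simp add: algebra_simps)
    finally show ?case .
  qed simp
  then show ?thesis
    by (simp add: binomial_fact field_simps)
qed

lemma rising_product_eq_0:
  assumes "x < 0" "x \<ge> - int q"
  shows "(\<Prod>t=1..q. real_of_int x + real t) = 0"
proof -
  have "nat (- x) \<in> {1..q}" "real_of_int x + real (nat (- x)) = 0"
    using assms by auto
  then show ?thesis by auto
qed

section \<open>Extracting the coefficient\<close>

theorem theorem3p2:
  fixes r k n :: nat and a :: "nat \<Rightarrow> nat"
  assumes "r \<ge> 1" and "k \<ge> 2" and "\<And>i. i \<in> {1..r} \<Longrightarrow> a i > 0"
  defines "D \<equiv> seq_lcm r a"
  shows "real (restricted_multipartition k r a n) =
    1 / fact (r * k - 1) *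
    (\<Sum>l \<in> {l \<in> box_C k r a. [(\<Sum>s=1..r. int (a s) * l s) = int n] (mod int D)}.
       (\<Prod>s=1..r. \<Sum>(i, j) \<in> {(i :: nat, j :: nat). int (i * (D div a s) + j) = l s}.
          (-1) ^ i * real (k choose i) * real ((j + k - 1) choose j)) *
       (\<Prod>t=1..r * k - 1.
          (real n - (\<Sum>s=1..r. real (a s) * real_of_int (l s))) / real D + real t))"
proof -
  define d where "d s = D div a s" for s
  define B where "B s = {0..int (k * (d s - 1))}" for s
  define W where "W l = (\<Sum>s=1..r. a s * nat (l s))" for l
  define C where "C l = (\<Prod>s=1..r. quotient_coeff k (d s) (l s))" for l
  define q where "q = r * k - 1"
  let ?L = "{l \<in> box_C k r a. [(\<Sum>s=1..r. int (a s) * l s) = int n] (mod int D)}"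
  have k: "k > 0" and rk: "r * k > 0" "r * k = Suc q" using assms by (auto simp: q_def)
  have a0: "a s > 0" if "s \<in> {1..r}" for s using assms(3)[OF that] .
  have "finite (a ` {1..r})" "0 \<notin> a ` {1..r}" using a0 by fastforce+
  then have D0: "D > 0" unfolding D_def seq_lcm_def by (metis Lcm_0_iff_nat gr0I)
  have ad: "a s * d s = D" if "s \<in> {1..r}" for s
    unfolding d_def D_def seq_lcm_def using that by (intro dvd_mult_div_cancel dvd_Lcm) auto
  have d0: "d s > 0" if "s \<in> {1..r}" for s using ad[OF that] D0 by (cases "d s = 0") auto
  have box: "box_C k r a = PiE {1..r} B"
  proof -
    have "real_of_int x \<le> real k * (real (seq_lcm r a) / real (a s) - 1) \<longleftrightarrow> x \<le> int (k * (d s - 1))"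
      if "s \<in> {1..r}" for s x
    proof -
      have "real (seq_lcm r a) / real (a s) = real (d s)"
        using a0[OF that] unfolding D_def[symmetric] ad[OF that, symmetric] by simp
      then have "real k * (real (seq_lcm r a) / real (a s) - 1) = real_of_int (int (k * (d s - 1)))"
        using d0[OF that] by (simp add: Suc_leI)
      then show ?thesis by (simp only: of_int_le_iff)
    qed
    then show ?thesis unfolding box_C_def B_def PiE_def Pi_def by fastforce
  qed
  have nonneg: "l s \<ge> 0" "l s \<le> int (k * (d s - 1))" if "l \<in> box_C k r a" "s \<in> {1..r}" for l s
    using that by (auto simp: box B_def PiE_iff)
  have Wint: "int (W l) = (\<Sum>s=1..r. int (a s) * l s)" if "l \<in> box_C k r a" for l
    using nonneg(1)[OF that] by (auto simp: W_def intro!: sum.cong)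
  have Wreal: "(\<Sum>s=1..r. real (a s) * real_of_int (l s)) = real (W l)" if "l \<in> box_C k r a" for l
    using arg_cong[OF Wint[OF that], of real_of_int] by simp
  have finB: "finite (B s)" for s by (simp add: B_def)
  have finbox: "finite (box_C k r a)" unfolding box by (simp add: finite_PiE finB)

  have "genfun (box_C k r a) W C = (\<Prod>s=1..r. genfun (B s) (\<lambda>l. a s * nat l) (quotient_coeff k (d s)))"
    unfolding box W_def C_def by (rule genfun_PiE(1)[symmetric]) (simp_all add: fin_fibres_finite finB)
  also have "\<dots> = (\<Prod>s=1..r. (1 - fps_X ^ D) ^ k * inverse ((1 - fps_X ^ a s) ^ k))"
  proof (rule prod.cong)
    fix s assume s: "s \<in> {1..r}"
    show "genfun (B s) (\<lambda>l. a s * nat l) (quotient_coeff k (d s)) =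
          (1 - fps_X ^ D) ^ k * inverse ((1 - fps_X ^ a s) ^ k)"
      unfolding B_def genfun_quotient_coeff[OF a0[OF s] d0[OF s] k] ad[OF s] ..
  qed simp
  also have "\<dots> = (1 - fps_X ^ D) ^ (r * k) * (\<Prod>s=1..r. inverse ((1 - fps_X ^ a s) ^ k))"
    by (simp add: prod.distrib mult.commute flip: power_mult)
  also have "(\<Prod>s=1..r. inverse ((1 - fps_X ^ a s) ^ k)) = Abs_fps (\<lambda>n. real (restricted_multipartition k r a n))"
    (is "_ = ?P") using a0 by (rule restricted_multipartition_fps[symmetric])
  finally have gbox: "genfun (box_C k r a) W C = (1 - fps_X ^ D) ^ (r * k) * ?P" .
  have "inverse ((1 - fps_X ^ D) ^ (r * k)) * (1 - fps_X ^ D) ^ (r * k) = (1 :: real fps)"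
    by (rule inverse_mult_eq_1) (use D0 in \<open>simp add: fps_power_zeroth zero_power\<close>)
  then have "?P = genfun (box_C k r a) W C * inverse ((1 - fps_X ^ D) ^ (r * k))"
    unfolding gbox by (simp add: ac_simps flip: mult.assoc)
  also have "\<dots> = genfun (box_C k r a) W C * genfun UNIV (\<lambda>m. D * m) (\<lambda>m. real ((m + q) choose m))"
    using genfun_negative_binomial[OF D0 rk(1)] rk(2) by simp
  also have "\<dots> = genfun (box_C k r a \<times> UNIV) (\<lambda>(l, m). W l + D * m) (\<lambda>(l, m). C l * real ((m + q) choose m))"
    by (rule genfun_mult) (simp_all add: fin_fibres_finite finbox fin_fibres_multiples D0)
  finally have "real (restricted_multipartition k r a n) =
     (\<Sum>p | p \<in> box_C k r a \<times> UNIV \<and> (\<lambda>(l, m). W l + D * m) p = n. (\<lambda>(l, m). C l * real ((m + q) choose m)) p)"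
    by (simp add: fps_eq_iff genfun_nth)
  \<comment> \<open>A box point \<open>l\<close> extends to a pair \<open>(l, m)\<close> of total weight \<open>n\<close> in at most one way, and it
    does so exactly if \<open>W l \<le> n\<close> and \<open>W l\<close> is congruent to \<open>n\<close> modulo \<open>D\<close>.\<close>
  also have "\<dots> = (\<Sum>l | l \<in> ?L \<and> W l \<le> n. C l * real (((n - W l) div D + q) choose ((n - W l) div D)))"
  proof (rule sum.reindex_bij_witness[where j = fst and i = "\<lambda>l. (l, (n - W l) div D)"])
    fix l assume l: "l \<in> {l. l \<in> ?L \<and> W l \<le> n}"
    then have "[int (W l) = int n] (mod int D)" using Wint by auto
    then have "[n = W l] (mod D)" by (simp add: cong_int_iff cong_sym)
    then have "D dvd n - W l" using l by (simp add: cong_altdef_nat)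
    then show "(l, (n - W l) div D) \<in> {p. p \<in> box_C k r a \<times> UNIV \<and> (\<lambda>(l, m). W l + D * m) p = n}"
      using l by auto
  next
    fix p assume p: "p \<in> {p. p \<in> box_C k r a \<times> UNIV \<and> (\<lambda>(l, m). W l + D * m) p = n}"
    obtain l m where lm: "p = (l, m)" by force
    with p have l: "l \<in> box_C k r a" and n: "n = W l + D * m" by auto
    have "[int (W l) = int n] (mod int D)" unfolding n by (simp add: cong_def)
    then show "fst p \<in> {l. l \<in> ?L \<and> W l \<le> n}" using l n Wint[OF l] lm by auto
    show "(fst p, (n - W (fst p)) div D) = p" using D0 n lm by simp
    show "C (fst p) * real (((n - W (fst p)) div D + q) choose ((n - W (fst p)) div D)) =
          (case p of (l, m) \<Rightarrow> C l * real ((m + q) choose m))" using D0 n lm by simp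
  qed auto
  \<comment> \<open>The points of \<open>?L\<close> with \<open>W l > n\<close> are added at no cost, because their product has a zero factor.\<close>
  also have "\<dots> = (\<Sum>l \<in> ?L. C l * ((\<Prod>t=1..q. (real n - real (W l)) / real D + real t) / fact q))"
  proof (rule sum.mono_neutral_cong_left)
    show "finite ?L" using finbox by simp
    show "{l. l \<in> ?L \<and> W l \<le> n} \<subseteq> ?L" by auto
    have quot: "\<exists>x. int n - int (W l) = int D * x \<and> (real n - real (W l)) / real D = real_of_int x"
      if l: "l \<in> ?L" for l
    proof -
      have "[int n = int (W l)] (mod int D)" using l Wint by (auto simp: cong_sym)
      then obtain x where x: "int n - int (W l) = int D * x" by (metis cong_iff_dvd_diff dvdE)
      from arg_cong[OF this, of real_of_int] have "(real n - real (W l)) / real D = real_of_int x"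
        using D0 by (simp add: field_simps)
      with x show ?thesis by blast
    qed
    show "\<forall>l\<in>?L - {l. l \<in> ?L \<and> W l \<le> n}. C l * ((\<Prod>t=1..q. (real n - real (W l)) / real D + real t) / fact q) = 0"
    proof
      fix l assume l: "l \<in> ?L - {l. l \<in> ?L \<and> W l \<le> n}"
      then obtain x where x: "int n - int (W l) = int D * x" "(real n - real (W l)) / real D = real_of_int x"
        using quot by blast
      have neg: "int D * x < 0" using l x by auto
      then have x0: "x < 0" using D0 by (simp add: mult_less_0_iff)
      \<comment> \<open>Strictness matters: it excludes the value \<open>- r * k\<close> for \<open>x\<close>, at which no factor vanishes.\<close>
      have "W l < r * (k * D)"
      proof -
        have "a s * nat (l s) < k * D" if s: "s \<in> {1..r}" for s
        proof -
          have "nat (l s) \<le> k * (d s - 1)" using nonneg(2)[of l s] l s by (simp only: nat_le_iff) simp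
          also have "\<dots> < k * d s" using k d0[OF s] by simp
          finally have "a s * nat (l s) < a s * (k * d s)" using a0[OF s] by simp
          also have "\<dots> = k * D" using ad[OF s] by (metis mult.left_commute)
          finally show ?thesis .
        qed
        then have "W l < (\<Sum>s=1..r. k * D)"
          unfolding W_def using assms(1) by (intro sum_strict_mono) auto
        then show ?thesis by simp
      qed
      then have "int (W l) < int D * int (r * k)" by (metis mult.assoc mult.commute of_nat_less_iff of_nat_mult)
      then have "int D * (- int (r * k)) < int D * x" using x(1) by simp
      then have "- int (r * k) < x" using D0 by (simp only: mult_less_cancel_left_pos of_nat_0_less_iff)
      then have "x \<ge> - int q" using rk(2) by simp
      from rising_product_eq_0[OF x0 this] show "C l * ((\<Prod>t=1..q. (real n - real (W l)) / real D + real t) / fact q) = 0"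
        unfolding x(2) by simp
    qed
    fix l assume l: "l \<in> {l. l \<in> ?L \<and> W l \<le> n}"
    then obtain x where x: "int n - int (W l) = int D * x" "(real n - real (W l)) / real D = real_of_int x"
      using quot by blast
    have "0 \<le> int D * x" using l x(1) by simp
    then have "x \<ge> 0" using D0 by (simp add: zero_le_mult_iff)
    then obtain m where m: "x = int m" using nonneg_int_cases by blast
    have "n - W l = D * m" using x(1) l unfolding m by (metis (no_types, lifting) mem_Collect_eq of_nat_diff of_nat_eq_iff of_nat_mult)
    then have md: "(n - W l) div D = m" using D0 by simp
    show "C l * real (((n - W l) div D + q) choose ((n - W l) div D)) =
      C l * ((\<Prod>t=1..q. (real n - real (W l)) / real D + real t) / fact q)"
      unfolding md x(2) m using rising_product_eq_binomial[of m q] by simp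
  qed
  also have "\<dots> = 1 / fact q * (\<Sum>l \<in> ?L. C l * (\<Prod>t=1..q. (real n - real (W l)) / real D + real t))"
    by (simp add: sum_distrib_left)
  also have "(\<Sum>l \<in> ?L. C l * (\<Prod>t=1..q. (real n - real (W l)) / real D + real t)) =
     (\<Sum>l \<in> ?L. (\<Prod>s=1..r. quotient_coeff k (d s) (l s)) *
       (\<Prod>t=1..q. (real n - (\<Sum>s=1..r. real (a s) * real_of_int (l s))) / real D + real t))"
    unfolding C_def by (rule sum.cong) (simp_all only: Wreal mem_Collect_eq)
  finally show ?thesis
    unfolding q_def d_def quotient_coeff_def .
qed

end
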